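(* Let $T$ be the rank-one transformation constructed by cutting each column $C_n$ in half and adding $2h_n+1$ spacers on top of the right subcolumn (and none on top of the left one); that is, $r_n=2$, $s_{n,0}=0$, $s_{n,1}=2h_n+1$ for all $n\ge 0$. Then $T$ is rationally ergodic and spectrally weakly mixing, but not rationally weakly mixing.
   Context: Rank-one transformations. A column is a finite ordered collection of pairwise disjoint intervals of $\mathbb{R}$ (called levels), all of the same length, thought of as stacked on top of each other. The column map $T_C$ of a column $C$ sends each point of a level other than the top one to the point directly above it in the next level (by translation); it is undefined on the top level. A rank-one (cutting-and-stacking) transformation $T$ is given by a sequence of columns $C_n$, $n\ge 0$: $C_0$ consists of the single level $I=(0,1)$; $C_{n+1}$ is obtained from $C_n$ by cutting $C_n$ into $r_n\ge 2$ subcolumns of equal width (numbered $0,\dots,r_n-1$ from left to right), adding $s_{n,k}\ge 0$ new levels ("spacers", new disjoint intervals) above the $k$-th subcolumn, and stacking every subcolumn under the subcolumn to its right. $X$ is the union of all levels of all columns, with Lebesgue measure $\mu$ and its Borel $\sigma$-algebra, and the levels are required to form a generating semiring for the $\sigma$-algebra. $T_{C_{n+1}}$ extends $T_{C_n}$, and $T$ is the limit of the $T_{C_n}$; it is an invertible measure-preserving transformation of $X$ (mod null sets). $h_n$ denotes the number of levels of $C_n$. $T$ is rationally ergodic if there exist a measurable set $F$ with $0<\mu(F)<\infty$ and a constant $M$ such that $\int_F (S_n(1_F))^2\,d\mu\le M\left(\int_F S_n(1_F)\,d\mu\right)^2$ for every $n\in\mathbb{N}$, where $S_n(f)=\sum_{k=0}^{n-1}f\circ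 T^k$. $T$ is spectrally weakly mixing if whenever $f\in L^\infty(X,\mu)$ and $f\circ T=zf$ for some $z\in\mathbb{C}$, then $f$ is constant a.e. For measurable $F$ with $0<\mu(F)<\infty$, $u_k(F)=\mu(F\cap T^kF)/\mu(F)^2$ and $a_n(F)=\sum_{k=0}^{n-1}u_k(F)$. $T$ is rationally weakly mixing if there exists a measurable $F\subset X$ with $0<\mu(F)<\infty$ such that for all measurable $A,B\subset F$, $$\frac{1}{a_n(F)}\sum_{k=0}^{n-1}\left|\mu(A\cap T^kB)-\mu(A)\mu(B)u_k(F)\right|\to 0\quad\text{as } n\to\infty.$$ *)

theory Defs
  imports "HOL-Analysis.Analysis"
begin

text \<open>
  All levels are open intervals, as the initial level \<open>(0,1)\<close> is. Cutting a level discards its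
  finitely many cut points, so the limit map below is specified off a countable set only.
\<close>

datatype column = Column (width: real) (lefts: "real list")

definition height :: "column \<Rightarrow> nat" where
  "height C = length (lefts C)"

definition level :: "column \<Rightarrow> nat \<Rightarrow> real set" where
  "level C i = {lefts C ! i <..< lefts C ! i + width C}"

definition is_column :: "column \<Rightarrow> bool" where
  "is_column C \<longleftrightarrow> 0 < width C \<and> 0 < height C \<and>
     (\<forall>i<height C. \<forall>j<height C. i \<noteq> j \<longrightarrow> level C i \<inter> level C j = {})"

text \<open>The graph of the partial map \<open>T\<^sub>C\<close>.\<close>

definition column_map :: "column \<Rightarrow> real \<Rightarrow> real \<Rightarrow> bool" where
  "column_map C x y \<longleftrightarrow>
     (\<exists>i. Suc i < height C \<and> x \<in> level C i \<and> y = x + (lefts C ! Suc i - lefts C ! i))"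

text \<open>Left endpoints of the \<open>k\<close>-th of the \<open>r\<close> subcolumns of \<open>C\<close>.\<close>

definition subcolumn :: "nat \<Rightarrow> column \<Rightarrow> nat \<Rightarrow> real list" where
  "subcolumn r C k = map (\<lambda>a. a + real k * (width C / real r)) (lefts C)"

text \<open>
  The lists \<open>sp k\<close> hold the left endpoints of the spacers; their position in \<open>\<real>\<close> is arbitrary
  subject to disjointness. That a spacer also misses the cut points of \<open>C\<close> follows from
  \<open>is_column C'\<close>: an open interval containing a cut point meets an adjacent sublevel.
\<close>

definition cut_and_stack :: "nat \<Rightarrow> (nat \<Rightarrow> nat) \<Rightarrow> column \<Rightarrow> column \<Rightarrow> bool" where
  "cut_and_stack r s C C' \<longleftrightarrow>
     is_column C' \<and> width C' = width C / real r \<and>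
     (\<exists>sp. (\<forall>k<r. length (sp k) = s k) \<and>
           lefts C' = concat (map (\<lambda>k. subcolumn r C k @ sp k) [0..<r]))"

text \<open>
  No separate hypothesis that the levels generate the Borel sets (mod null sets) is needed:
  since \<open>r n \<ge> 2\<close>, the widths of the columns tend to \<open>0\<close>.
\<close>

definition rank_one_columns ::
    "(nat \<Rightarrow> nat) \<Rightarrow> (nat \<Rightarrow> nat \<Rightarrow> nat) \<Rightarrow> (nat \<Rightarrow> column) \<Rightarrow> bool" where
  "rank_one_columns r s C \<longleftrightarrow>
     C 0 = Column 1 [0] \<and>
     (\<forall>n. 2 \<le> r n \<and> cut_and_stack (r n) (s n) (C n) (C (Suc n)))"

definition rank_one_space :: "(nat \<Rightarrow> column) \<Rightarrow> real measure" where
  "rank_one_space C = restrict_space lborel (\<Union>n. \<Union>i<height (C n). level (C n) i)"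

text \<open>
  \<open>T\<close> is a version of the limit of the column maps: it extends all of them, and its values on
  the remaining countable subset of \<open>X\<close> are arbitrary points of \<open>X\<close>.
\<close>

definition rank_one_map :: "(nat \<Rightarrow> column) \<Rightarrow> (real \<Rightarrow> real) \<Rightarrow> bool" where
  "rank_one_map C T \<longleftrightarrow>
     T \<in> rank_one_space C \<rightarrow>\<^sub>M rank_one_space C \<and>
     (\<forall>n x y. column_map (C n) x y \<longrightarrow> T x = y)"

definition birkhoff_sum :: "('a \<Rightarrow> 'a) \<Rightarrow> nat \<Rightarrow> ('a \<Rightarrow> real) \<Rightarrow> 'a \<Rightarrow> real" where
  "birkhoff_sum T n f x = (\<Sum>k<n. f ((T ^^ k) x))"

definition rationally_ergodic :: "'a measure \<Rightarrow> ('a \<Rightarrow> 'a) \<Rightarrow> bool" where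
  "rationally_ergodic M T \<longleftrightarrow>
     (\<exists>F\<in>sets M. 0 < emeasure M F \<and> emeasure M F < \<infinity> \<and>
       (\<exists>K::real. \<forall>n.
          (LINT x:F|M. (birkhoff_sum T n (indicator F) x)\<^sup>2)
            \<le> K * (LINT x:F|M. birkhoff_sum T n (indicator F) x)\<^sup>2))"

definition spectrally_weakly_mixing :: "'a measure \<Rightarrow> ('a \<Rightarrow> 'a) \<Rightarrow> bool" where
  "spectrally_weakly_mixing M T \<longleftrightarrow>
     (\<forall>(f :: 'a \<Rightarrow> complex) (z :: complex).
        f \<in> borel_measurable M \<longrightarrow>
        (\<exists>B::real. AE x in M. norm (f x) \<le> B) \<longrightarrow>
        (AE x in M. f (T x) = z * f x) \<longrightarrow>
        (\<exists>c. AE x in M. f x = c))"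

text \<open>
  \<open>T\<^sup>k F\<close> is the forward image. For a rank-one map it is a Borel set, because the map is a countable
  piecewise translation off a countable set.
\<close>

definition intrinsic_weight :: "'a measure \<Rightarrow> ('a \<Rightarrow> 'a) \<Rightarrow> 'a set \<Rightarrow> nat \<Rightarrow> real" where
  "intrinsic_weight M T F k = measure M (F \<inter> (T ^^ k) ` F) / (measure M F)\<^sup>2"

definition rationally_weakly_mixing :: "'a measure \<Rightarrow> ('a \<Rightarrow> 'a) \<Rightarrow> bool" where
  "rationally_weakly_mixing M T \<longleftrightarrow>
     (\<exists>F\<in>sets M. 0 < emeasure M F \<and> emeasure M F < \<infinity> \<and>
       (\<forall>A\<in>sets M. \<forall>B\<in>sets M. A \<subseteq> F \<longrightarrow> B \<subseteq> F \<longrightarrow>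
         (\<lambda>n. 1 / (\<Sum>k<n. intrinsic_weight M T F k) *
              (\<Sum>k<n. \<bar>measure M (A \<inter> (T ^^ k) ` B)
                        - measure M A * measure M B * intrinsic_weight M T F k\<bar>))
           \<longlonglongrightarrow> 0))"

end

theory Submission
  imports Defs
begin

text \<open>
  The heights satisfy \<open>h\<^sub>0 = 1\<close> and \<open>h\<^sub>n\<^sub>+\<^sub>1 = 4h\<^sub>n + 1\<close>, so \<open>h\<^sub>N > 3(h\<^sub>0 + \<dots> + h\<^sub>N\<^sub>-\<^sub>1)\<close> and an expansion
  \<open>\<Sum>c\<^sub>jh\<^sub>j\<close> with digits \<open>0 \<le> c\<^sub>j \<le> 2\<close> determines its digits. Up to a countable set, the \<open>i\<close>-th level of
  \<open>C\<^sub>m\<close> is the union of the levels \<open>i + \<Sum>\<^bsub>j\<in>D\<^esub> h\<^sub>j\<close> of \<open>C\<^sub>N\<close>, where \<open>D \<subseteq> {m..<N}\<close>.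

  Rational ergodicity holds with \<open>F = (0,1)\<close>: if \<open>2h\<^sub>m \<le> n < 2h\<^sub>m\<^sub>+\<^sub>1\<close>, then \<open>S\<^sub>n(1\<^sub>F) \<le> 2\<^sup>m\<^sup>+\<^sup>2\<close> a.e. on \<open>F\<close>,
  while \<open>S\<^sub>n(1\<^sub>F) \<ge> 2\<^sup>m\<close> on a subset of \<open>F\<close> of measure \<open>1/2\<close>.

  If \<open>f \<circ> T = zf\<close>, the integrals \<open>a\<^sub>n\<close> of \<open>f\<close> over the bottom levels satisfy
  \<open>a\<^sub>n = (1 + z\<^bsup>h\<^sub>n\<^esup>)a\<^sub>n\<^sub>+\<^sub>1\<close>. As \<open>f\<close> is bounded, either all \<open>a\<^sub>n\<close> vanish or \<open>z\<^bsup>h\<^sub>n\<^esup> \<longlonglongrightarrow> 1\<close>; in the second case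
  the recursion for \<open>h\<^sub>n\<close> gives \<open>z = 1\<close>, and \<open>f\<close> has the same mean on all levels.

  Rational weak mixing fails for every \<open>F\<close>: choose a level both of whose halves meet \<open>F\<close> in sets \<open>A\<close>, \<open>B\<close>
  of positive measure. By uniqueness of digits, for each \<open>k\<close> one of \<open>\<mu>(A \<inter> T\<^sup>kA)\<close>, \<open>\<mu>(A \<inter> T\<^sup>kB)\<close> is zero, so
  the averages for \<open>(A,A)\<close> and \<open>(A,B)\<close> add up to at least \<open>min(\<mu>(A)\<^sup>2, \<mu>(A)\<mu>(B))\<close>.
\<close>

section \<open>Heights and their digit expansions\<close>

text \<open>The column heights, by \<open>height_C\<close>: two halves of height \<open>ht n\<close>
  and \<open>2 * ht n + 1\<close> spacers.\<close>

primrec ht :: "nat \<Rightarrow> nat" where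
  "ht 0 = 1"
| "ht (Suc n) = 4 * ht n + 1"

text \<open>The factor 3 exceeds the largest digit 2, so expansions have no carries; the surplus
  \<open>N + 1\<close> later leaves room for time shifts.\<close>

lemma ht_eq_sum: "ht N = 3 * (\<Sum>j<N. ht j) + N + 1"
  by (induction N) auto

lemma sum_ht_le:
  assumes "D \<subseteq> {..<N}"
  shows "sum ht D \<le> (\<Sum>j<N. ht j)"
  using assms by (intro sum_mono2) auto

lemma sum_ht_less:
  assumes "D \<subseteq> {..<N}"
  shows "3 * sum ht D + N < ht N"
  using sum_ht_le[OF assms] ht_eq_sum[of N] by linarith

lemma ht_mono: "m \<le> n \<Longrightarrow> ht m \<le> ht n"
  by (induction rule: dec_induct) auto

lemma less_ht: "n < ht n"
  using ht_eq_sum[of n] by simp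

lemma ht_add_sum_less:
  assumes "i < ht m" "m \<le> N" "D \<subseteq> {m..<N}"
  shows "i + sum ht D < ht N"
  using assms(2,3)
proof (induction N arbitrary: D rule: dec_induct)
  case base
  then show ?case using assms(1) by simp
next
  case (step N)
  have "D - {N} \<subseteq> {m..<N}" using step.prems by auto
  then have "i + sum ht (D - {N}) < ht N" by (rule step.IH)
  moreover have "sum ht D \<le> ht N + sum ht (D - {N})"
    using finite_subset[OF step.prems] sum.remove[of D N ht] by (cases "N \<in> D") auto
  ultimately show ?case by simp
qed

text \<open>Room for \<open>k\<close> steps of \<open>T\<close> inside \<open>C N\<close>. As
  \<open>j\<close> numbers a half of a level of \<open>C m\<close>, it costs up to two copies of
  \<open>ht m\<close>. Adding the bounds for \<open>insert m D\<close> and for \<open>{m}\<close>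
  covers \<open>3 * j + 3 * sum ht D\<close>; their slack together with \<open>N < ht N\<close> pays
  for \<open>k\<close>.\<close>

lemma add_sum_ht_less:
  assumes "j < 2 * ht m" "D \<subseteq> {Suc m..<N}" "m < N" "k \<le> N"
  shows "j + sum ht D + k < ht N"
proof -
  have "finite D" "m \<notin> D" "insert m D \<subseteq> {..<N}"
    using assms(2,3) finite_subset by auto
  then have "3 * (ht m + sum ht D) + N < ht N"
    using sum_ht_less[of "insert m D" N] by simp
  moreover have "3 * ht m + N < ht N"
    using sum_ht_less[of "{m}" N] assms(3) by auto
  moreover have "3 * j < 3 * ht m + 3 * ht m" using assms(1) by simp
  ultimately have "3 * (j + sum ht D + k) < 3 * ht N"
    using assms(4) less_ht[of N] unfolding distrib_left by linarith
  then show ?thesis by simp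
qed

text \<open>The part of an expansion below position \<open>N\<close> is less than
  \<open>ht N\<close>, so division by \<open>ht N\<close> reads off the leading digit, and induction
  does the rest.\<close>

lemma digits_le_2_unique:
  assumes "\<And>j. j < N \<Longrightarrow> c j \<le> 2" "\<And>j. j < N \<Longrightarrow> d j \<le> 2"
    and "(\<Sum>j<N. c j * ht j) = (\<Sum>j<N. d j * ht j)" "j < N"
  shows "c j = d j"
  using assms
proof (induction N)
  case 0
  then show ?case by simp
next
  case (Suc N)
  have small: "(\<Sum>j<N. e j * ht j) < ht N" if "\<And>j. j < Suc N \<Longrightarrow> e j \<le> 2" for e :: "nat \<Rightarrow> nat"
  proof -
    have "(\<Sum>j<N. e j * ht j) \<le> (\<Sum>j<N. 2 * ht j)"
      using that by (intro sum_mono mult_right_mono) auto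
    also have "\<dots> < ht N"
      using ht_eq_sum[of N] by (simp flip: sum_distrib_left)
    finally show ?thesis .
  qed
  have "(ht N * c N + (\<Sum>j<N. c j * ht j)) div ht N = (ht N * d N + (\<Sum>j<N. d j * ht j)) div ht N"
    using Suc.prems(3) by (simp add: mult.commute add.commute)
  then have N: "c N = d N"
    using small[of c] small[of d] Suc.prems(1,2) by simp
  then have "(\<Sum>j<N. c j * ht j) = (\<Sum>j<N. d j * ht j)"
    using Suc.prems(3) by simp
  then show ?case
    using N Suc by (cases "j = N") auto
qed

lemma sum_ht_digits:
  assumes "D \<subseteq> {..<N}"
  shows "sum ht D = (\<Sum>j<N. of_bool (j \<in> D) * ht j)"
proof -
  have "sum ht D = (\<Sum>j\<in>D. of_bool (j \<in> D) * ht j)" by simp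
  also have "\<dots> = (\<Sum>j<N. of_bool (j \<in> D) * ht j)"
    using assms by (intro sum.mono_neutral_left) auto
  finally show ?thesis .
qed

lemma inj_on_sum_ht: "inj_on (sum ht) (Pow {..<N})"
proof (rule inj_onI)
  fix D E assume DE: "D \<in> Pow {..<N}" "E \<in> Pow {..<N}" "sum ht D = sum ht E"
  have eq: "(\<Sum>j<N. of_bool (j \<in> D) * ht j) = (\<Sum>j<N. of_bool (j \<in> E) * ht j)"
    using DE sum_ht_digits[of D N] sum_ht_digits[of E N] by auto
  have "j \<in> D \<longleftrightarrow> j \<in> E" if "j < N" for j
  proof -
    have "(of_bool (j \<in> D) :: nat) = of_bool (j \<in> E)"
      by (rule digits_le_2_unique[OF _ _ eq that]) (auto simp: of_bool_def)
    then show ?thesis by (simp only: of_bool_eq_iff)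
  qed
  then show "D = E" using DE(1,2) by blast
qed

text \<open>Adding two 0/1 expansions keeps all digits at most 2, so both sides can be read
  uniquely; the digit at \<open>m\<close> is 1 on the left and 0 on the right.\<close>

lemma no_ht_relation:
  assumes "D1 \<subseteq> {Suc m..<N}" "D2 \<subseteq> {Suc m..<N}" "D3 \<subseteq> {Suc m..<N}" "D4 \<subseteq> {Suc m..<N}" "m < N"
  shows "ht m + sum ht D1 + sum ht D2 \<noteq> sum ht D3 + sum ht D4"
proof
  assume eq: "ht m + sum ht D1 + sum ht D2 = sum ht D3 + sum ht D4"
  define c where "c j = (of_bool (j = m) + of_bool (j \<in> D1) + of_bool (j \<in> D2) :: nat)" for j
  define d where "d j = (of_bool (j \<in> D3) + of_bool (j \<in> D4) :: nat)" for j
  have sub: "D1 \<subseteq> {..<N}" "D2 \<subseteq> {..<N}" "D3 \<subseteq> {..<N}" "D4 \<subseteq> {..<N}" "{m} \<subseteq> {..<N}"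
    using assms by auto
  have "(\<Sum>j<N. c j * ht j) = sum ht {m} + sum ht D1 + sum ht D2"
    unfolding c_def sum_ht_digits[OF sub(1)] sum_ht_digits[OF sub(2)] sum_ht_digits[OF sub(5)]
    by (simp add: sum.distrib distrib_right del: sum.lessThan_Suc)
  moreover have "(\<Sum>j<N. d j * ht j) = sum ht D3 + sum ht D4"
    unfolding d_def sum_ht_digits[OF sub(3)] sum_ht_digits[OF sub(4)]
    by (simp add: sum.distrib distrib_right)
  ultimately have "(\<Sum>j<N. c j * ht j) = (\<Sum>j<N. d j * ht j)" using eq by simp
  moreover have "c j \<le> 2" "d j \<le> 2" for j
    using assms by (auto simp: c_def d_def of_bool_def)
  ultimately have "c m = d m"
    using \<open>m < N\<close> by (intro digits_le_2_unique[of N c d]) auto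
  moreover have "m \<notin> D1" "m \<notin> D2" "m \<notin> D3" "m \<notin> D4" using assms by auto
  ultimately show False by (simp add: c_def d_def)
qed

text \<open>If the leading digits, at position \<open>N\<close>, differ, the values are at least
  \<open>ht N\<close> minus the sum of the lower heights apart. Since \<open>Suc m < N\<close>,
  \<open>ht (Suc m)\<close> is one of the lower heights, and \<open>ht_eq_sum\<close> makes that gap
  exceed \<open>2 * ht (Suc m)\<close>.\<close>

lemma digits_agree_if_close:
  assumes "\<And>j. j < N \<Longrightarrow> c j \<le> 1" "\<And>j. j < N \<Longrightarrow> d j \<le> 1"
    and "(\<Sum>j<N. c j * ht j) < (\<Sum>j<N. d j * ht j) + 2 * ht (Suc m)"
    and "(\<Sum>j<N. d j * ht j) < (\<Sum>j<N. c j * ht j) + 2 * ht (Suc m)"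
    and "m + 2 \<le> j" "j < N"
  shows "c j = d j"
  using assms
proof (induction N)
  case 0
  then show ?case by simp
next
  case (Suc N)
  have small: "(\<Sum>j<N. e j * ht j) \<le> (\<Sum>j<N. ht j)" if "\<And>j. j < Suc N \<Longrightarrow> e j \<le> 1" for e :: "nat \<Rightarrow> nat"
    using that by (intro sum_mono) auto
  have "Suc m < N" using Suc.prems(5,6) by auto
  then have "ht (Suc m) \<le> (\<Sum>j<N. ht j)" by (intro member_le_sum) auto
  then have big: "(\<Sum>j<N. ht j) + 2 * ht (Suc m) < ht N" using ht_eq_sum[of N] by linarith
  have N: "c N = d N"
  proof (rule ccontr)
    assume "c N \<noteq> d N"
    then consider "c N = 0" "d N = 1" | "c N = 1" "d N = 0"
      using Suc.prems(1)[of N] Suc.prems(2)[of N] by linarith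
    then show False
      using Suc.prems(3,4) small[of c] small[of d] Suc.prems(1,2) big by cases auto
  qed
  then show ?case
    using Suc by (cases "j = N") auto
qed

text \<open>All digits from \<open>m + 2\<close> on agree with those of \<open>D\<close>, so at most
  \<open>m + 2\<close> digits are free. Such a window arises from \<open>n\<close> consecutive
  iterates of a point.\<close>

lemma card_window_le:
  assumes "D \<subseteq> {..<N}" "n \<le> 2 * ht (Suc m)"
  shows "card {E. E \<subseteq> {..<N} \<and> sum ht D \<le> sum ht E \<and> sum ht E < sum ht D + n} \<le> 2 ^ (m + 2)"
    (is "card ?W \<le> _")
proof -
  have agree: "E \<inter> {m+2..} = D \<inter> {m+2..}" if "E \<in> ?W" for E
  proof -
    have E: "E \<subseteq> {..<N}" using that by simp
    have "(of_bool (j \<in> E) :: nat) = of_bool (j \<in> D)" if "m + 2 \<le> j" "j < N" for j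
      using \<open>E \<in> ?W\<close> assms that
      by (intro digits_agree_if_close[of N _ _ m])
        (auto simp flip: sum_ht_digits[OF E] sum_ht_digits[OF assms(1)])
    then have "j \<in> E \<longleftrightarrow> j \<in> D" if "m + 2 \<le> j" "j < N" for j
      using that by (simp only: of_bool_eq_iff)
    then show ?thesis using E assms(1) by (fastforce simp: subset_iff)
  qed
  have "inj_on (\<lambda>E. E \<inter> {..<m+2}) ?W"
  proof (rule inj_onI)
    fix E E' assume EE: "E \<in> ?W" "E' \<in> ?W" and low: "E \<inter> {..<m+2} = E' \<inter> {..<m+2}"
    have split: "G = G \<inter> {..<m+2} \<union> G \<inter> {m+2..}" for G by auto
    show "E = E'"
      using split[of E] split[of E'] low agree[OF EE(1)] agree[OF EE(2)] by simp
  qed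
  then have "card ?W \<le> card (Pow {..<m+2})"
    by (intro card_inj_on_le[of "\<lambda>E. E \<inter> {..<m+2}"]) auto
  then show ?thesis by (simp add: card_Pow)
qed

section \<open>The columns\<close>

locale half_cut =
  fixes C :: "nat \<Rightarrow> column" and T :: "real \<Rightarrow> real"
  assumes columns: "rank_one_columns (\<lambda>n. 2) (\<lambda>n k. if k = 1 then 2 * height (C n) + 1 else 0) C"
    and map: "rank_one_map C T"
begin

abbreviation lv :: "nat \<Rightarrow> nat \<Rightarrow> real set" where
  "lv n i \<equiv> level (C n) i"

abbreviation lo :: "nat \<Rightarrow> nat \<Rightarrow> real" where
  "lo n i \<equiv> lefts (C n) ! i"

abbreviation M :: "real measure" where
  "M \<equiv> rank_one_space C"

text \<open>The midpoints at which levels are cut; off this countable set each level is exactly the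
  union of its two halves.\<close>

definition cuts :: "real set" where
  "cuts = (\<Union>n. \<Union>i<ht n. {lo n i + (1/2) ^ Suc n})"

lemma column_0: "C 0 = Column 1 [0]"
  using columns by (simp add: rank_one_columns_def)

lemma column_Suc:
  obtains sp where "length sp = 2 * height (C n) + 1"
    "lefts (C (Suc n)) = lefts (C n) @ map (\<lambda>a. a + width (C n) / 2) (lefts (C n)) @ sp"
    "width (C (Suc n)) = width (C n) / 2" "is_column (C (Suc n))"
proof -
  have "cut_and_stack 2 (\<lambda>k. if k = 1 then 2 * height (C n) + 1 else 0) (C n) (C (Suc n))"
    using columns by (simp add: rank_one_columns_def)
  then obtain sp where sp: "\<And>k. k < 2 \<Longrightarrow> length (sp k) = (if k = 1 then 2 * height (C n) + 1 else 0)"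
      "lefts (C (Suc n)) = concat (map (\<lambda>k. subcolumn 2 (C n) k @ sp k) [0..<2])"
    and C: "is_column (C (Suc n))" "width (C (Suc n)) = width (C n) / 2"
    unfolding cut_and_stack_def by auto
  have "[0..<2] = [0, 1::nat]" by (simp add: upt_rec)
  moreover have "sp 0 = []" using sp(1)[of 0] by simp
  ultimately have "lefts (C (Suc n)) =
      lefts (C n) @ map (\<lambda>a. a + width (C n) / 2) (lefts (C n)) @ sp 1"
    using sp(2) by (simp add: subcolumn_def)
  then show ?thesis using that[of "sp 1"] sp(1)[of 1] C by simp
qed

lemma height_C: "height (C n) = ht n"
proof (induction n)
  case 0
  then show ?case by (simp add: column_0 height_def)
next
  case (Suc n)
  then show ?case by (rule_tac n = n in column_Suc) (auto simp: height_def)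
qed

lemma width_C: "width (C n) = (1/2) ^ n"
proof (induction n)
  case 0
  then show ?case by (simp add: column_0)
next
  case (Suc n)
  then show ?case by (rule_tac n = n in column_Suc) auto
qed

lemma lo_left: "i < ht n \<Longrightarrow> lo (Suc n) i = lo n i"
  by (rule column_Suc[of n]) (auto simp: nth_append height_def simp flip: height_C)

lemma lo_right: "i < ht n \<Longrightarrow> lo (Suc n) (ht n + i) = lo n i + (1/2) ^ Suc n"
  by (rule column_Suc[of n]) (auto simp: nth_append height_def width_C simp flip: height_C)

lemma is_column_C: "is_column (C n)"
proof (cases n)
  case 0
  then show ?thesis by (simp add: column_0 is_column_def height_def)
next
  case (Suc m)
  then show ?thesis by (auto intro: column_Suc[of m])
qed

section \<open>Levels and their refinement in later columns\<close>

lemma lv_eq: "lv n i = {lo n i <..< lo n i + (1/2) ^ n}"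
  by (simp add: level_def width_C)

lemma lv_disjoint: "i < ht n \<Longrightarrow> j < ht n \<Longrightarrow> i \<noteq> j \<Longrightarrow> lv n i \<inter> lv n j = {}"
  using is_column_C[of n] by (auto simp: is_column_def height_C)

lemma lv_eqI: "x \<in> lv n i \<Longrightarrow> x \<in> lv n j \<Longrightarrow> i < ht n \<Longrightarrow> j < ht n \<Longrightarrow> i = j"
  using lv_disjoint by blast

lemma lv_0_0: "lv 0 0 = {0<..<1}"
  by (simp add: level_def column_0)

lemma open_lv [simp]: "open (lv n i)"
  by (simp add: level_def)

lemma lv_left_subset: "i < ht n \<Longrightarrow> lv (Suc n) i \<subseteq> lv n i"
  and lv_right_subset: "i < ht n \<Longrightarrow> lv (Suc n) (ht n + i) \<subseteq> lv n i"
  by (auto simp: lv_eq lo_left lo_right)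

lemma lv_split:
  assumes "x \<in> lv n i" "i < ht n" "x \<notin> cuts"
  shows "x \<in> lv (Suc n) i \<or> x \<in> lv (Suc n) (ht n + i)"
proof -
  have "x \<noteq> lo n i + (1/2) ^ Suc n" using assms by (auto simp: cuts_def)
  then show ?thesis
    using assms by (auto simp: lv_eq lo_left lo_right)
qed

lemma countable_cuts: "countable cuts"
  by (auto simp: cuts_def)

text \<open>Each cut puts \<open>x\<close> in the left half, which keeps its index, or in the right
  half, which adds \<open>ht N\<close>; \<open>D\<close> records the right turns.\<close>

lemma lv_descend:
  assumes "x \<in> lv m i" "i < ht m" "x \<notin> cuts" "m \<le> N"
  obtains D where "D \<subseteq> {m..<N}" "x \<in> lv N (i + sum ht D)"
proof -
  have "\<exists>D\<subseteq>{m..<N}. x \<in> lv N (i + sum ht D)"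
    using assms(4)
  proof (induction rule: dec_induct)
    case base
    then show ?case using assms(1) by auto
  next
    case (step N)
    then obtain D where D: "D \<subseteq> {m..<N}" "x \<in> lv N (i + sum ht D)" by auto
    then have "x \<in> lv (Suc N) (i + sum ht D) \<or> x \<in> lv (Suc N) (ht N + (i + sum ht D))"
      using lv_split[OF D(2) ht_add_sum_less assms(3)] assms(2) step.hyps by blast
    moreover have "sum ht (insert N D) = ht N + sum ht D"
      using D(1) finite_subset[OF D(1)] by (subst sum.insert) auto
    then have "i + sum ht (insert N D) = ht N + (i + sum ht D)" by simp
    ultimately have "x \<in> lv (Suc N) (i + sum ht D) \<or> x \<in> lv (Suc N) (i + sum ht (insert N D))"
      by (simp only:)
    moreover have "D \<subseteq> {m..<Suc N}" "insert N D \<subseteq> {m..<Suc N}"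
      using D(1) step.hyps by auto
    ultimately show ?case by blast
  qed
  then show thesis using that by blast
qed

lemma lv_ascend:
  assumes "m \<le> N" "i < ht m" "D \<subseteq> {m..<N}"
  shows "lv N (i + sum ht D) \<subseteq> lv m i"
  using assms(1,3)
proof (induction N arbitrary: D rule: dec_induct)
  case base
  then show ?case by simp
next
  case (step N)
  define E where "E = D - {N}"
  have E: "E \<subseteq> {m..<N}" using step.prems by (auto simp: E_def)
  have less: "i + sum ht E < ht N"
    using ht_add_sum_less[OF assms(2) step.hyps(1) E] .
  have "i + sum ht D = i + sum ht E \<or> i + sum ht D = ht N + (i + sum ht E)"
    using finite_subset[OF step.prems] sum.remove[of D N ht]
    by (cases "N \<in> D") (auto simp: E_def)
  then have "lv (Suc N) (i + sum ht D) \<subseteq> lv N (i + sum ht E)"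
    using lv_left_subset[OF less] lv_right_subset[OF less] by (elim disjE) (simp_all only:)
  then show ?case using step.IH[OF E] by auto
qed

lemma open_diff_cuts_nonempty:
  assumes "open U" "x \<in> U"
  obtains y where "y \<in> U" "y \<notin> cuts"
proof -
  obtain e where "e > 0" "ball x e \<subseteq> U" using assms openE by blast
  then have "uncountable U"
    using uncountable_ball countable_subset by blast
  then have "\<not> U \<subseteq> cuts" using countable_cuts countable_subset by blast
  then show thesis using that by blast
qed

text \<open>Since \<open>x\<close> itself may be a cut point, it is replaced by a point off the cuts
  in the open intersection of the two levels, whose digits can be followed.\<close>

lemma lv_meet:
  assumes "x \<in> lv m i" "i < ht m" "x \<in> lv N j" "j < ht N" "m \<le> N"
  obtains D where "D \<subseteq> {m..<N}" "j = i + sum ht D"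
proof -
  have "open (lv m i \<inter> lv N j)" "x \<in> lv m i \<inter> lv N j" using assms by auto
  then obtain y where y: "y \<in> lv m i \<inter> lv N j" "y \<notin> cuts"
    by (rule open_diff_cuts_nonempty)
  obtain D where D: "D \<subseteq> {m..<N}" "y \<in> lv N (i + sum ht D)"
    using lv_descend[of y m i N] y assms by auto
  then have "j = i + sum ht D"
    using y assms ht_add_sum_less[OF assms(2,5) D(1)] by (intro lv_eqI[of y N]) auto
  then show thesis using that D by blast
qed

section \<open>The action of \<open>T\<close> on levels\<close>

lemma T_lv: "x \<in> lv n i \<Longrightarrow> Suc i < ht n \<Longrightarrow> T x = x + (lo n (Suc i) - lo n i)"
  using map unfolding rank_one_map_def column_map_def height_C by blast

lemma T_pow_lv:
  assumes "x \<in> lv n i" "i + k < ht n"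
  shows "(T ^^ k) x \<in> lv n (i + k)"
  using assms(2)
proof (induction k)
  case 0
  then show ?case using assms(1) by simp
next
  case (Suc k)
  then have "T ((T ^^ k) x) = (T ^^ k) x + (lo n (Suc (i + k)) - lo n (i + k))"
    by (intro T_lv) auto
  then show ?case using Suc by (auto simp: lv_eq)
qed

section \<open>The measure space and its null sets\<close>

lemma space_M: "space M = (\<Union>n. \<Union>i<ht n. lv n i)"
  by (simp add: rank_one_space_def space_restrict_space height_C)

lemma open_space_M: "open (space M)"
  unfolding space_M by (intro open_UN ballI open_lv)

lemma M_eq: "M = restrict_space lborel (space M)"
  by (simp add: rank_one_space_def space_restrict_space)

lemma sets_M_iff: "A \<in> sets M \<longleftrightarrow> A \<in> sets borel \<and> A \<subseteq> space M"
  using open_space_M by (subst M_eq, subst sets_restrict_space_iff) auto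

lemma sigma_finite_M: "sigma_finite_measure M"
  using sigma_finite_measure_restrict_space[OF sigma_finite_lborel, of "space M"] open_space_M
  by (simp flip: M_eq)

lemma emeasure_M: "A \<in> sets M \<Longrightarrow> emeasure M A = emeasure lborel A"
  using open_space_M by (subst M_eq, subst emeasure_restrict_space) (auto simp: sets_M_iff)

lemma lv_subset_space: "i < ht n \<Longrightarrow> lv n i \<subseteq> space M"
  unfolding space_M by blast

lemma lv_sets [simp]: "i < ht n \<Longrightarrow> lv n i \<in> sets M"
  by (simp add: sets_M_iff lv_subset_space)

lemma emeasure_lv: "i < ht n \<Longrightarrow> emeasure M (lv n i) = ennreal ((1/2) ^ n)"
  by (simp add: emeasure_M) (simp add: lv_eq)

lemma measure_lv: "i < ht n \<Longrightarrow> measure M (lv n i) = (1/2) ^ n"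
  by (simp add: measure_def emeasure_lv)

lemma countable_null_sets: "countable A \<Longrightarrow> A \<subseteq> space M \<Longrightarrow> A \<in> null_sets M"
  by (intro null_setsI)
    (auto simp: emeasure_M sets_M_iff countable_imp_null_set_lborel sets.countable emeasure_lborel_countable)

text \<open>If \<open>A\<close> is not in \<open>sets M\<close>, \<open>measure\<close> takes its
  default value 0.\<close>

lemma measure_countable: "countable A \<Longrightarrow> measure M A = 0"
  by (cases "A \<in> sets M")
    (auto simp: measure_notin_sets measure_eq_emeasure_eq_ennreal emeasure_M emeasure_lborel_countable)

lemma AE_not_cuts: "AE x in M. x \<notin> cuts"
proof (rule AE_I')
  show "cuts \<inter> space M \<in> null_sets M"
    using countable_cuts by (intro countable_null_sets) auto
qed auto

lemma T_measurable [measurable]: "T \<in> M \<rightarrow>\<^sub>M M"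
  using map by (simp add: rank_one_map_def)

lemma T_pow_measurable [measurable]: "T ^^ k \<in> M \<rightarrow>\<^sub>M M"
  by (induction k) (auto simp: id_def intro: measurable_comp T_measurable)

section \<open>Failure of rational weak mixing\<close>

text \<open>Otherwise one half of every level carries none of \<open>F\<close>, so the whole mass of
  \<open>F\<close> in a level passes to ever narrower levels and must vanish.\<close>

lemma positive_halves:
  assumes "F \<in> sets M" "0 < emeasure M F"
  obtains m i where "i < ht m" "0 < emeasure M (F \<inter> lv (Suc m) i)"
    "0 < emeasure M (F \<inter> lv (Suc m) (ht m + i))"
proof (rule ccontr)
  assume neg: "\<not> thesis"
  note halves = that
  have half: "emeasure M (F \<inter> lv (Suc m) i) = 0 \<or> emeasure M (F \<inter> lv (Suc m) (ht m + i)) = 0"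
    if "i < ht m" for m i
    using that halves neg by (meson zero_less_iff_neq_zero)
  have null: "emeasure M (F \<inter> lv m i) = 0" if i: "i < ht m" for m i
  proof -
    have step: "\<exists>j<ht (m + k). emeasure M (F \<inter> lv m i) \<le> emeasure M (F \<inter> lv (m + k) j)" for k
    proof (induction k)
      case 0
      then show ?case using i by auto
    next
      case (Suc k)
      then obtain j where j: "j < ht (m + k)"
        "emeasure M (F \<inter> lv m i) \<le> emeasure M (F \<inter> lv (m + k) j)" by auto
      let ?l = "F \<inter> lv (Suc (m + k)) j" and ?r = "F \<inter> lv (Suc (m + k)) (ht (m + k) + j)"
      have lt: "j < ht (Suc (m + k))" "ht (m + k) + j < ht (Suc (m + k))" using j by auto
      have sets: "?l \<in> sets M" "?r \<in> sets M" "F \<inter> lv (m + k) j \<in> sets M"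
        using assms(1) j lt by (auto simp del: ht.simps)
      have "emeasure M (F \<inter> lv (m + k) j) \<le> emeasure M (?l \<union> ?r)"
        using AE_not_cuts
        by (intro emeasure_mono_AE sets.Un sets, elim eventually_mono) (use lv_split j(1) in blast)
      also have "\<dots> \<le> emeasure M ?l + emeasure M ?r"
        by (intro emeasure_subadditive sets)
      finally have "emeasure M (F \<inter> lv (m + k) j) \<le> emeasure M ?l \<or>
          emeasure M (F \<inter> lv (m + k) j) \<le> emeasure M ?r"
        using half[OF j(1)] by auto
      then show ?case using j(2) lt order_trans by (metis add_Suc_right)
    qed
    have "emeasure M (F \<inter> lv m i) \<le> ennreal ((1/2) ^ k)" for k
    proof -
      obtain j where j: "j < ht (m + k)" "emeasure M (F \<inter> lv m i) \<le> emeasure M (F \<inter> lv (m + k) j)"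
        using step by blast
      note j(2)
      also have "emeasure M (F \<inter> lv (m + k) j) \<le> emeasure M (lv (m + k) j)"
        using j(1) by (intro emeasure_mono) auto
      also have "\<dots> \<le> ennreal ((1/2) ^ k)"
        by (simp add: emeasure_lv j(1) ennreal_leI power_decreasing)
      finally show ?thesis .
    qed
    moreover have "(\<lambda>k. ennreal ((1/2) ^ k)) \<longlonglongrightarrow> ennreal 0"
      by (intro tendsto_ennrealI LIMSEQ_power_zero) simp
    ultimately have "emeasure M (F \<inter> lv m i) \<le> ennreal 0"
      by (intro LIMSEQ_le_const) auto
    then show ?thesis by simp
  qed
  have "F = (\<Union>m. \<Union>i<ht m. F \<inter> lv m i)"
    using sets.sets_into_space[OF assms(1)] unfolding space_M by blast
  also have "\<dots> \<in> null_sets M"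
    using null assms(1) by (intro null_sets_UN null_sets_UN' countable_finite null_setsI) auto
  finally show False using assms(2) by auto
qed

text \<open>A point of \<open>B\<close> that reaches \<open>A\<close> climbs \<open>k\<close> levels
  of \<open>C N\<close> without leaving the column; comparing its level numbers before and after
  gives the relation.\<close>

lemma T_pow_meet:
  assumes "measure M (A \<inter> (T ^^ k) ` B) \<noteq> 0"
    and "A \<subseteq> lv (Suc m) i" "B \<subseteq> lv (Suc m) j" "i < 2 * ht m" "j < 2 * ht m"
    and "m < N" "k \<le> N"
  obtains D E where "D \<subseteq> {Suc m..<N}" "E \<subseteq> {Suc m..<N}" "j + sum ht D + k = i + sum ht E"
proof -
  \<comment> \<open>Only points off \<open>cuts\<close> have digits; the image of
    \<open>cuts\<close> under \<open>T ^^ k\<close> is countable, so it cannot carry the nonzero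
    measure.\<close>
  have "\<not> A \<inter> (T ^^ k) ` B \<subseteq> (T ^^ k) ` cuts"
  proof
    assume "A \<inter> (T ^^ k) ` B \<subseteq> (T ^^ k) ` cuts"
    then have "countable (A \<inter> (T ^^ k) ` B)"
      by (rule countable_subset) (intro countable_image countable_cuts)
    then show False using assms(1) measure_countable by blast
  qed
  then obtain x where x: "x \<in> B" "x \<notin> cuts" "(T ^^ k) x \<in> A" by blast
  have ij: "i < ht (Suc m)" "j < ht (Suc m)" using assms(4,5) by auto
  obtain D where D: "D \<subseteq> {Suc m..<N}" "x \<in> lv N (j + sum ht D)"
    using lv_descend[of x "Suc m" j N] x assms ij by (auto simp del: ht.simps)
  have less: "j + sum ht D + k < ht N"
    using add_sum_ht_less assms(5-7) D(1) by blast
  then have "(T ^^ k) x \<in> lv N (j + sum ht D + k)"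
    by (rule T_pow_lv[OF D(2)])
  moreover have "(T ^^ k) x \<in> lv (Suc m) i" "Suc m \<le> N" using x(3) assms(2,6) by auto
  ultimately obtain E where "E \<subseteq> {Suc m..<N}" "j + sum ht D + k = i + sum ht E"
    using lv_meet ij(1) less by metis
  then show thesis using that D(1) by blast
qed

text \<open>A return from \<open>A\<close> to \<open>A\<close> makes \<open>k\<close> a difference
  of two 0/1 expansions with digits above \<open>m\<close>; a passage from \<open>B\<close> to
  \<open>A\<close> does the same for \<open>k + ht m\<close>. Eliminating \<open>k\<close> gives the
  equality excluded by \<open>no_ht_relation\<close>.\<close>

lemma correlations_disjoint:
  assumes "i < ht m" "A \<subseteq> lv (Suc m) i" "B \<subseteq> lv (Suc m) (ht m + i)"
  shows "measure M (A \<inter> (T ^^ k) ` A) = 0 \<or> measure M (A \<inter> (T ^^ k) ` B) = 0"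
proof (rule ccontr)
  assume neg: "\<not> ?thesis"
  define N where "N = m + 1 + k"
  have N: "m < N" "k \<le> N" by (auto simp: N_def)
  have i: "i < 2 * ht m" "ht m + i < 2 * ht m" using assms(1) by auto
  obtain D E where DE: "D \<subseteq> {Suc m..<N}" "E \<subseteq> {Suc m..<N}" "i + sum ht D + k = i + sum ht E"
    using T_pow_meet[OF _ assms(2,2) i(1,1) N] neg by blast
  obtain D' E' where DE': "D' \<subseteq> {Suc m..<N}" "E' \<subseteq> {Suc m..<N}"
      "ht m + i + sum ht D' + k = i + sum ht E'"
    using T_pow_meet[OF _ assms(2,3) i N] neg by blast
  have "ht m + sum ht D' + sum ht E = sum ht E' + sum ht D"
    using DE(3) DE'(3) by linarith
  then show False
    using no_ht_relation[OF DE'(1) DE(2) DE'(2) DE(1) N(1)] by blast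
qed

lemma not_rationally_weakly_mixing: "\<not> rationally_weakly_mixing M T"
proof
  assume "rationally_weakly_mixing M T"
  then obtain F where F: "F \<in> sets M" "0 < emeasure M F" "emeasure M F < \<infinity>"
    and lim: "\<And>A B. A \<in> sets M \<Longrightarrow> B \<in> sets M \<Longrightarrow> A \<subseteq> F \<Longrightarrow> B \<subseteq> F \<Longrightarrow>
      (\<lambda>n. 1 / (\<Sum>k<n. intrinsic_weight M T F k) *
        (\<Sum>k<n. \<bar>measure M (A \<inter> (T ^^ k) ` B) - measure M A * measure M B * intrinsic_weight M T F k\<bar>))
      \<longlonglongrightarrow> 0"
    unfolding rationally_weakly_mixing_def by auto
  obtain m i where i: "i < ht m" "0 < emeasure M (F \<inter> lv (Suc m) i)"
    "0 < emeasure M (F \<inter> lv (Suc m) (ht m + i))"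
    using positive_halves F(1,2) by blast
  define A where "A = F \<inter> lv (Suc m) i"
  define B where "B = F \<inter> lv (Suc m) (ht m + i)"
  define a where "a = measure M A"
  define b where "b = measure M B"
  define w where "w = intrinsic_weight M T F"
  define c where "c = min (a * a) (a * b)"
  have lt: "i < ht (Suc m)" "ht m + i < ht (Suc m)" using i(1) by auto
  have AB: "A \<in> sets M" "B \<in> sets M" "A \<subseteq> F" "B \<subseteq> F"
    using F(1) lt by (auto simp: A_def B_def simp del: ht.simps)
  have pos: "0 < measure M G" if "0 < emeasure M G" "G \<subseteq> F" for G
    using that emeasure_mono[OF that(2) F(1)] F(3)
    by (simp add: measure_def enn2real_positive_iff)
  have "a > 0" "b > 0" using i AB pos by (auto simp: a_def b_def A_def B_def)
  then have "c > 0" by (simp add: c_def)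
  have w_nonneg: "0 \<le> w k" for k by (simp add: w_def intrinsic_weight_def)
  \<comment> \<open>Positivity of the term at time 0 makes the normalising sum nonzero from
    \<open>n = 1\<close> on.\<close>
  have w0: "0 < w 0" using pos[OF F(2)] by (simp add: w_def intrinsic_weight_def)
  \<comment> \<open>One of the two correlations vanishes, so its summand equals
    \<open>a * a * w k\<close> or \<open>a * b * w k\<close>, each at least
    \<open>c * w k\<close>.\<close>
  have summand: "c * w k \<le> \<bar>measure M (A \<inter> (T ^^ k) ` A) - a * a * w k\<bar> +
      \<bar>measure M (A \<inter> (T ^^ k) ` B) - a * b * w k\<bar>" for k
  proof -
    have le: "c * w k \<le> a * a * w k" "c * w k \<le> a * b * w k" "0 \<le> c * w k"
      using w_nonneg[of k] \<open>c > 0\<close> by (auto simp: c_def intro!: mult_right_mono)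
    have "measure M (A \<inter> (T ^^ k) ` A) = 0 \<or> measure M (A \<inter> (T ^^ k) ` B) = 0"
      by (rule correlations_disjoint[OF i(1)]) (auto simp: A_def B_def)
    then show ?thesis using le by auto
  qed
  have "c \<le> 1 / (\<Sum>k<n. w k) * (\<Sum>k<n. \<bar>measure M (A \<inter> (T ^^ k) ` A) - a * a * w k\<bar>) +
      1 / (\<Sum>k<n. w k) * (\<Sum>k<n. \<bar>measure M (A \<inter> (T ^^ k) ` B) - a * b * w k\<bar>)" if "1 \<le> n" for n
  proof -
    have "w 0 \<le> (\<Sum>k<n. w k)" using that w_nonneg by (intro member_le_sum) auto
    then have W: "0 < (\<Sum>k<n. w k)" using w0 by linarith
    have "c * (\<Sum>k<n. w k) \<le> (\<Sum>k<n. \<bar>measure M (A \<inter> (T ^^ k) ` A) - a * a * w k\<bar>) +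
        (\<Sum>k<n. \<bar>measure M (A \<inter> (T ^^ k) ` B) - a * b * w k\<bar>)"
      using summand by (auto simp: sum_distrib_left sum_mono simp flip: sum.distrib)
    then show ?thesis using W by (simp add: field_simps)
  qed
  moreover have "(\<lambda>n. 1 / (\<Sum>k<n. w k) * (\<Sum>k<n. \<bar>measure M (A \<inter> (T ^^ k) ` A) - a * a * w k\<bar>) +
      1 / (\<Sum>k<n. w k) * (\<Sum>k<n. \<bar>measure M (A \<inter> (T ^^ k) ` B) - a * b * w k\<bar>)) \<longlonglongrightarrow> 0 + 0"
    unfolding w_def a_def b_def using AB by (intro tendsto_add lim)
  ultimately have "c \<le> 0 + 0" by (intro LIMSEQ_le_const) auto
  then show False using \<open>c > 0\<close> by simp
qed

section \<open>Rational ergodicity\<close>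

definition visits :: "nat \<Rightarrow> real \<Rightarrow> nat set" where
  "visits n x = {k. k < n \<and> (T ^^ k) x \<in> {0<..<1}}"

lemma birkhoff_sum_eq_card_visits:
  "birkhoff_sum T n (indicator {0<..<1}) x = real (card (visits n x))"
proof -
  have "birkhoff_sum T n (indicator {0<..<1}) x = (\<Sum>k\<in>visits n x. 1)"
    unfolding birkhoff_sum_def
    by (rule sum.mono_neutral_cong_right) (auto simp: visits_def indicator_def)
  then show ?thesis by simp
qed

text \<open>Column \<open>C n\<close> has room for all times \<open>k < n\<close> above level
  \<open>sum ht D\<close>. A visit lands on a level \<open>sum ht E\<close>, so the visit times are
  counted by the window of \<open>card_window_le\<close>.\<close>

lemma card_visits_le:
  assumes "x \<in> {0<..<1}" "x \<notin> cuts" "n \<le> 2 * ht (Suc m)"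
  shows "card (visits n x) \<le> 2 ^ (m + 2)"
proof -
  obtain D where D: "D \<subseteq> {..<n}" "x \<in> lv n (sum ht D)"
    using lv_descend[of x 0 0 n] assms lv_0_0 by (auto simp: atLeast0LessThan)
  define W where "W = {E. E \<subseteq> {..<n} \<and> sum ht D \<le> sum ht E \<and> sum ht E < sum ht D + n}"
  have "finite W" by (rule finite_subset[of _ "Pow {..<n}"]) (auto simp: W_def)
  have "visits n x \<subseteq> (\<lambda>E. sum ht E - sum ht D) ` W"
  proof
    fix k assume "k \<in> visits n x"
    then have k: "k < n" "(T ^^ k) x \<in> lv 0 0" by (auto simp: visits_def lv_0_0)
    have less: "sum ht D + k < ht n" using sum_ht_less[OF D(1)] k(1) by linarith
    then have "(T ^^ k) x \<in> lv n (sum ht D + k)" by (rule T_pow_lv[OF D(2)])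
    then obtain E where "E \<subseteq> {0..<n}" "sum ht D + k = 0 + sum ht E"
      using lv_meet[OF k(2) _ _ less] by auto
    then have "E \<in> W" "k = sum ht E - sum ht D"
      using k(1) by (auto simp: W_def atLeast0LessThan)
    then show "k \<in> (\<lambda>E. sum ht E - sum ht D) ` W" by blast
  qed
  then have "card (visits n x) \<le> card W"
    using \<open>finite W\<close> by (meson card_image_le card_mono finite_imageI order_trans)
  then show ?thesis using card_window_le[OF D(1) assms(3)] unfolding W_def by linarith
qed

text \<open>In \<open>C (Suc m)\<close> these points have digit 0 at \<open>m\<close>. Climbing to
  any level \<open>ht m + sum ht E\<close> with \<open>E\<close> below \<open>m\<close> is a visit,
  at a time less than \<open>2 * ht m\<close>; the \<open>2 ^ m\<close> choices of \<open>E\<close>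
  give distinct times. The subtraction is exact because \<open>sum ht D < ht m\<close>.\<close>

lemma card_visits_ge:
  assumes "x \<in> lv (Suc m) (sum ht D)" "D \<subseteq> {..<m}" "2 * ht m \<le> n"
  shows "2 ^ m \<le> card (visits n x)"
proof -
  let ?g = "\<lambda>E. ht m + sum ht E - sum ht D"
  have D: "sum ht D < ht m" using sum_ht_less[OF assms(2)] by linarith
  have "?g ` Pow {..<m} \<subseteq> visits n x"
  proof
    fix k assume "k \<in> ?g ` Pow {..<m}"
    then obtain E where E: "E \<subseteq> {..<m}" "k = ?g E" by blast
    have less: "sum ht E < ht m" using sum_ht_less[OF E(1)] by linarith
    have k: "sum ht D + k = ht m + sum ht E" using E(2) D by simp
    have "finite E" "m \<notin> E" using E(1) finite_subset by auto
    then have "ht m + sum ht E = 0 + sum ht (insert m E)" by simp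
    moreover have "lv (Suc m) (0 + sum ht (insert m E)) \<subseteq> lv 0 0"
      using E(1) by (intro lv_ascend) auto
    moreover have "(T ^^ k) x \<in> lv (Suc m) (sum ht D + k)"
      using less k by (intro T_pow_lv[OF assms(1)]) auto
    ultimately have "(T ^^ k) x \<in> {0<..<1}" using k lv_0_0 by auto
    moreover have "k < n" using k less assms(3) by linarith
    ultimately show "k \<in> visits n x" by (simp add: visits_def)
  qed
  moreover have "inj_on ?g (Pow {..<m})"
  proof (rule inj_onI)
    fix E E' assume "E \<in> Pow {..<m}" "E' \<in> Pow {..<m}" "?g E = ?g E'"
    moreover have "sum ht E = sum ht E'" using \<open>?g E = ?g E'\<close> D by linarith
    ultimately show "E = E'" using inj_on_sum_ht by (meson inj_onD)
  qed
  moreover have "finite (visits n x)" by (simp add: visits_def)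
  ultimately have "card (Pow {..<m}) \<le> card (visits n x)"
    by (metis card_image card_mono)
  then show ?thesis by (simp add: card_Pow)
qed

text \<open>Up to cut points, \<open>G m\<close> is the part of the unit interval with digit 0 at
  \<open>m\<close>, to which \<open>card_visits_ge\<close> applies: \<open>2 ^ m\<close> levels of
  length \<open>(1/2) ^ Suc m\<close>.\<close>

lemma measure_low_sublevels:
  defines "G m \<equiv> \<Union>D\<in>Pow {..<m}. lv (Suc m) (sum ht D)"
  shows "measure M (G m) = 1/2" "G m \<in> sets M" "G m \<subseteq> {0<..<1}"
proof -
  have lt: "sum ht D < ht (Suc m)" if "D \<in> Pow {..<m}" for D
    using sum_ht_less[of D m] that by auto
  have "disjoint_family_on (\<lambda>D. lv (Suc m) (sum ht D)) (Pow {..<m})"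
    unfolding disjoint_family_on_def
  proof (intro ballI impI)
    fix D E assume DE: "D \<in> Pow {..<m}" "E \<in> Pow {..<m}" "D \<noteq> E"
    then have "sum ht D \<noteq> sum ht E" using inj_on_sum_ht by (meson inj_onD)
    then show "lv (Suc m) (sum ht D) \<inter> lv (Suc m) (sum ht E) = {}"
      using lv_disjoint lt DE by blast
  qed
  then have "measure M (G m) = (\<Sum>D\<in>Pow {..<m}. measure M (lv (Suc m) (sum ht D)))"
    unfolding G_def using lt emeasure_lv
    by (intro measure_finite_Union) (auto simp del: ht.simps)
  also have "\<dots> = (\<Sum>D\<in>Pow {..<m}. (1/2) ^ Suc m)"
    using lt by (intro sum.cong measure_lv) auto
  also have "\<dots> = 1/2" by (simp add: card_Pow power_one_over)
  finally show "measure M (G m) = 1/2" .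
  show "G m \<in> sets M" unfolding G_def using lt by (intro sets.finite_UN) auto
  have "lv (Suc m) (0 + sum ht D) \<subseteq> lv 0 0" if "D \<in> Pow {..<m}" for D
    using that by (intro lv_ascend) auto
  then show "G m \<subseteq> {0<..<1}" unfolding G_def lv_0_0 by auto
qed

lemma measurable_birkhoff [measurable]:
  assumes "F \<in> sets M"
  shows "birkhoff_sum T n (indicator F) \<in> borel_measurable M"
proof -
  have "(\<lambda>x. indicator F ((T ^^ k) x) :: real) \<in> borel_measurable M" for k
    using assms by (intro measurable_compose[OF T_pow_measurable]) auto
  then show ?thesis unfolding birkhoff_sum_def by (intro borel_measurable_sum)
qed

lemma rationally_ergodic: "rationally_ergodic M T"
proof -
  define F :: "real set" where "F = {0<..<1}"
  define S where "S n = birkhoff_sum T n (indicator F)" for n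
  have F: "F \<in> sets M" "emeasure M F = 1"
    using lv_sets[of 0 0] emeasure_lv[of 0 0] lv_0_0 by (auto simp: F_def)
  have S: "S n x = real (card (visits n x))" for n x
    unfolding S_def F_def by (rule birkhoff_sum_eq_card_visits)
  have S_le: "0 \<le> S n x" "S n x \<le> n" for n x
    using card_mono[of "{..<n}" "visits n x"] by (auto simp: S visits_def)
  have S_meas [measurable]: "S n \<in> borel_measurable M" for n
    unfolding S_def using F(1) by (rule measurable_birkhoff)
  note [measurable] = F(1)
  have int: "integrable M (\<lambda>x. indicator A x * (c::real))" if "A \<in> sets M" "A \<subseteq> F" for A c
    using that F emeasure_mono[OF that(2) F(1)]
    by (intro integrable_mult_left integrable_real_indicator) (auto simp: order_le_less_trans)
  have int2: "integrable M (\<lambda>x. indicator F x * (S n x)\<^sup>2)" for n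
    by (rule Bochner_Integration.integrable_bound[OF int[OF F(1) order_refl, of "(real n)\<^sup>2"]])
      (use S_le in \<open>auto simp: indicator_def abs_le_square_iff[symmetric]\<close>)
  have int1: "integrable M (\<lambda>x. indicator F x * S n x)" for n
    by (rule Bochner_Integration.integrable_bound[OF int[OF F(1) order_refl, of "real n"]])
      (use S_le in \<open>auto simp: indicator_def\<close>)
  have upper: "(LINT x:F|M. (S n x)\<^sup>2) \<le> 16 * 4 ^ m" if "n \<le> 2 * ht (Suc m)" for n m
  proof -
    have "(LINT x:F|M. (S n x)\<^sup>2) \<le> (\<integral>x. indicator F x * (2 ^ (m + 2))\<^sup>2 \<partial>M)"
      unfolding set_lebesgue_integral_def real_scaleR_def
    proof (rule integral_mono_AE[OF int2 int[OF F(1) order_refl]])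
      show "AE x in M. indicator F x * (S n x)\<^sup>2 \<le> indicator F x * (2 ^ (m + 2))\<^sup>2"
        using AE_not_cuts
      proof eventually_elim
        case (elim x)
        have "S n x \<le> 2 ^ (m + 2)" if "x \<in> F"
          using card_visits_le[OF _ elim \<open>n \<le> _\<close>] that unfolding S F_def
          by (metis of_nat_le_iff of_nat_numeral of_nat_power)
        then have "(S n x)\<^sup>2 \<le> (2 ^ (m + 2))\<^sup>2" if "x \<in> F"
          using that S_le(1) by (intro power_mono)
        then show ?case by (cases "x \<in> F") simp_all
      qed
    qed
    also have "\<dots> = 16 * 4 ^ m"
      using F by (simp add: measure_def power2_eq_square power_add flip: power_mult_distrib)
    finally show ?thesis .
  qed
  have lower: "2 ^ m / 2 \<le> (LINT x:F|M. S n x)" if n: "2 * ht m \<le> n" for n m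
  proof -
    define G where "G = (\<Union>D\<in>Pow {..<m}. lv (Suc m) (sum ht D))"
    note G = measure_low_sublevels[of m, folded G_def F_def]
    have "(2 ^ m / 2 :: real) = (\<integral>x. indicator G x * 2 ^ m \<partial>M)"
      using G(1,2) by (simp add: Int_absorb2 sets.sets_into_space)
    also have "\<dots> \<le> (LINT x:F|M. S n x)"
      unfolding set_lebesgue_integral_def real_scaleR_def
    proof (rule integral_mono[OF int[OF G(2,3)] int1])
      fix x
      show "indicator G x * 2 ^ m \<le> indicator F x * S n x"
      proof (cases "x \<in> G")
        case True
        then obtain D where "D \<subseteq> {..<m}" "x \<in> lv (Suc m) (sum ht D)" by (auto simp: G_def)
        then have "2 ^ m \<le> card (visits n x)" using card_visits_ge n by blast
        then have "2 ^ m \<le> S n x" unfolding S by (metis of_nat_le_iff of_nat_numeral of_nat_power)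
        then show ?thesis using True G(3) by auto
      qed (use S_le in simp)
    qed
    finally show ?thesis .
  qed
  \<comment> \<open>The constant 64 compares \<open>16 * 4 ^ m\<close> with the square of
    \<open>2 ^ m / 2\<close>. The ranges beginning at \<open>2 * ht m\<close> start at 2 because
    \<open>ht 0 = 1\<close>, so \<open>n = 0\<close> and \<open>n = 1\<close> are treated
    separately.\<close>
  have "(LINT x:F|M. (S n x)\<^sup>2) \<le> 64 * (LINT x:F|M. S n x)\<^sup>2" for n
  proof -
    consider "n = 0" | "n = 1" | "n \<ge> 2" by linarith
    then show ?thesis
    proof cases
      case 1
      then show ?thesis by (simp add: S visits_def set_lebesgue_integral_def)
    next
      case 2
      have "S 1 x = 1" if "x \<in> F" for x
        using that by (simp add: S_def birkhoff_sum_def)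
      then have "(LINT x:F|M. S n x) = (LINT x:F|M. 1)" "(LINT x:F|M. (S n x)\<^sup>2) = (LINT x:F|M. 1)"
        using 2 F(1) by (auto intro!: set_lebesgue_integral_cong)
      moreover have "(LINT x:F|M. 1) = (1::real)"
        using F by (simp add: set_lebesgue_integral_def measure_def Int_absorb2 sets.sets_into_space)
      ultimately show ?thesis by simp
    next
      case 3
      then have "\<not> n < 2 * ht 0" "n < 2 * ht n" using less_ht[of n] by auto
      then obtain m where "2 * ht m \<le> n" "n < 2 * ht (Suc m)"
        using ex_least_nat_less[of "\<lambda>m. n < 2 * ht m" n] by (metis not_less order_refl)
      then have "(LINT x:F|M. (S n x)\<^sup>2) \<le> 16 * 4 ^ m" "2 ^ m / 2 \<le> (LINT x:F|M. S n x)"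
        using upper lower by auto
      moreover have "16 * 4 ^ m = 64 * (2 ^ m / 2 :: real)\<^sup>2"
        by (simp add: power2_eq_square flip: power_mult_distrib)
      moreover have "(2 ^ m / 2)\<^sup>2 \<le> (LINT x:F|M. S n x)\<^sup>2"
        using calculation(2) by (intro power_mono) auto
      ultimately show ?thesis by linarith
    qed
  qed
  then show ?thesis
    unfolding rationally_ergodic_def S_def
    by (intro bexI[of _ F] conjI exI[of _ 64] allI) (use F in auto)
qed

end

section \<open>Spectral weak mixing\<close>

lemma unimodular_parallelogram:
  fixes w :: complex
  assumes "norm w \<le> 1"
  shows "(norm (1 - w))\<^sup>2 \<le> 4 - (norm (1 + w))\<^sup>2"
proof -
  have "(norm (1 - w))\<^sup>2 + (norm (1 + w))\<^sup>2 = 2 + 2 * (norm w)\<^sup>2"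
    unfolding cmod_power2 by (simp add: power2_eq_square algebra_simps)
  moreover have "(norm w)\<^sup>2 \<le> 1" using assms by (simp add: power_le_one)
  ultimately show ?thesis by linarith
qed

text \<open>The modulus of \<open>z\<close> is not given. If it is at most 1,
  \<open>2 ^ n * norm (a n)\<close> increases to a positive limit, which forces
  \<open>norm (1 + z ^ ht n)\<close> to tend to 2. If it exceeds 1, levels high up in a column
  violate \<open>bound\<close>.\<close>

lemma eigenvalue_eq_1:
  fixes z :: complex and a :: "nat \<Rightarrow> complex"
  assumes rec: "\<And>n. a n = (1 + z ^ ht n) * a (Suc n)"
    and bound: "\<And>n i. i < ht n \<Longrightarrow> norm (z ^ i * a n) \<le> B * (1/2) ^ n"
    and "a m \<noteq> 0"
  shows "z = 1"
proof (cases "norm z \<le> 1")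
  case True
  then have w_le: "norm (z ^ n) \<le> 1" for n by (simp add: norm_power power_le_one)
  define b where "b n = 2 ^ n * norm (a n)" for n
  have b_rec: "b n = norm (1 + z ^ ht n) / 2 * b (Suc n)" for n
    unfolding b_def using rec[of n] by (simp add: norm_mult)
  have "norm (1 + z ^ n) \<le> 2" for n
    using norm_triangle_ineq[of 1 "z ^ n"] w_le[of n] by simp
  then have "b n \<le> 1 * b (Suc n)" for n
    unfolding b_rec[of n] by (intro mult_right_mono) (auto simp: b_def)
  then have inc: "incseq b" by (intro incseq_SucI) simp
  have b_le: "b n \<le> B" for n
    using bound[of 0 n] by (simp add: b_def ht_eq_sum[of n] power_one_over field_simps)
  obtain l where l: "b \<longlonglongrightarrow> l" "\<And>n. b n \<le> l"
    using incseq_convergent[OF inc] b_le by blast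
  have "0 < b m" using \<open>a m \<noteq> 0\<close> by (simp add: b_def)
  then have "0 < l" using l(2)[of m] by linarith
  have b_pos: "0 < b n" if "m \<le> n" for n
    using \<open>0 < b m\<close> incseqD[OF inc that] by linarith
  have "(\<lambda>n. 2 * b n / b (Suc n)) \<longlonglongrightarrow> 2 * l / l"
    using l(1) \<open>0 < l\<close> by (intro tendsto_intros LIMSEQ_Suc) auto
  moreover have "\<forall>\<^sub>F n in sequentially. 2 * b n / b (Suc n) = norm (1 + z ^ ht n)"
    using eventually_ge_at_top[of m]
  proof eventually_elim
    case (elim n)
    then have "b (Suc n) \<noteq> 0" using b_pos[of "Suc n"] by simp
    then show ?case using b_rec[of n] by (simp add: field_simps)
  qed
  ultimately have "(\<lambda>n. norm (1 + z ^ ht n)) \<longlonglongrightarrow> 2 * l / l"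
    by (rule Lim_transform_eventually)
  then have "(\<lambda>n. norm (1 + z ^ ht n)) \<longlonglongrightarrow> 2" using \<open>0 < l\<close> by simp
  then have "(\<lambda>n. 4 - (norm (1 + z ^ ht n))\<^sup>2) \<longlonglongrightarrow> 4 - 2\<^sup>2"
    by (intro tendsto_diff tendsto_power tendsto_const)
  then have "(\<lambda>n. 4 - (norm (1 + z ^ ht n))\<^sup>2) \<longlonglongrightarrow> 0" by simp
  \<comment> \<open>The parallelogram law turns \<open>norm (1 + w)\<close> near 2 into
    \<open>w\<close> near 1 when \<open>norm w \<le> 1\<close>.\<close>
  moreover have "\<forall>\<^sub>F n in sequentially.
      norm ((norm (1 - z ^ ht n))\<^sup>2) \<le> 4 - (norm (1 + z ^ ht n))\<^sup>2"
    using unimodular_parallelogram[OF w_le] by simp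
  ultimately have "(\<lambda>n. (norm (1 - z ^ ht n))\<^sup>2) \<longlonglongrightarrow> 0"
    by (rule Lim_null_comparison[rotated])
  then have "(\<lambda>n. norm (1 - z ^ ht n)) \<longlonglongrightarrow> 0"
    by (simp add: power_tendsto_0_iff)
  then have "(\<lambda>n. 1 - (1 - z ^ ht n)) \<longlonglongrightarrow> 1 - 0"
    by (intro tendsto_diff tendsto_const) (simp add: tendsto_norm_zero_iff)
  then have lim: "(\<lambda>n. z ^ ht n) \<longlonglongrightarrow> 1" by simp
  \<comment> \<open>Since \<open>ht (Suc n) = 4 * ht n + 1\<close>, the powers
    \<open>z ^ ht (Suc n)\<close> tend both to 1 and to \<open>1 ^ 4 * z\<close>.\<close>
  have "(\<lambda>n. (z ^ ht n) ^ 4 * z) \<longlonglongrightarrow> 1 ^ 4 * z"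
    by (intro tendsto_intros lim)
  moreover have "(z ^ ht n) ^ 4 * z = z ^ ht (Suc n)" for n
    by (simp add: mult.commute flip: power_mult)
  ultimately have "(\<lambda>n. z ^ ht (Suc n)) \<longlonglongrightarrow> z" by simp
  then show ?thesis using LIMSEQ_Suc[OF lim] LIMSEQ_unique by blast
next
  case False
  define r where "r = norm z"
  have r: "1 < r" using False by (simp add: r_def)
  \<comment> \<open>Iterate \<open>rec\<close> with \<open>norm (1 + z ^ h) \<le> 2 * r ^ h\<close>.
    Summing heights from 0 instead of \<open>m\<close> weakens the bound but matches
    \<open>ht_eq_sum\<close>.\<close>
  have grow: "norm (a m) \<le> 2 ^ p * r ^ (\<Sum>k<m+p. ht k) * norm (a (m + p))" for p
  proof (induction p)
    case 0
    have "1 \<le> r ^ (\<Sum>k<m. ht k)" using r by (simp add: one_le_power)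
    then show ?case using mult_right_mono[of 1 _ "norm (a m)"] by simp
  next
    case (Suc p)
    have "norm (1 + z ^ ht (m + p)) \<le> 1 + r ^ ht (m + p)"
      by (rule norm_triangle_le) (simp add: norm_power r_def)
    also have "\<dots> \<le> 2 * r ^ ht (m + p)" using r by (simp add: one_le_power)
    finally have "norm (a (m + p)) \<le> 2 * r ^ ht (m + p) * norm (a (Suc (m + p)))"
      unfolding rec[of "m + p"] norm_mult by (intro mult_right_mono) auto
    then have "2 ^ p * r ^ (\<Sum>k<m+p. ht k) * norm (a (m + p)) \<le>
        2 ^ p * r ^ (\<Sum>k<m+p. ht k) * (2 * r ^ ht (m + p) * norm (a (Suc (m + p))))"
      using r by (intro mult_left_mono) auto
    also have "\<dots> = 2 ^ Suc p * r ^ (\<Sum>k<m+Suc p. ht k) * norm (a (m + Suc p))"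
      by (simp add: power_add)
    finally show ?case using Suc by linarith
  qed
  have "norm (a 0) \<le> B" using bound[of 0 0] by simp
  then have B: "0 \<le> B" using norm_ge_zero[of "a 0"] by linarith
  \<comment> \<open>By \<open>ht_eq_sum\<close>, the index \<open>?s + p\<close> is below
    \<open>ht (m + p)\<close>. Applying \<open>bound\<close> there absorbs the growth
    \<open>r ^ ?s\<close> and the factor \<open>2 ^ p\<close>, leaving a spare factor
    \<open>r ^ p\<close>.\<close>
  have le_B: "norm (a m) * r ^ p \<le> B" for p
  proof -
    let ?s = "\<Sum>k<m+p. ht k"
    have "norm (a m) * r ^ p \<le> 2 ^ p * r ^ ?s * norm (a (m + p)) * r ^ p"
      using grow r by (intro mult_right_mono) auto
    also have "\<dots> = 2 ^ p * (r ^ (?s + p) * norm (a (m + p)))"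
      by (simp add: power_add mult_ac)
    also have "r ^ (?s + p) * norm (a (m + p)) = norm (z ^ (?s + p) * a (m + p))"
      by (simp add: norm_mult norm_power r_def)
    also have "\<dots> \<le> B * (1/2) ^ (m + p)"
      by (rule bound) (use ht_eq_sum[of "m + p"] in linarith)
    also have "2 ^ p * (B * (1/2) ^ (m + p)) = B * (1/2) ^ m"
      by (simp add: power_add power_one_over)
    also have "\<dots> \<le> B" using B by (intro mult_left_le) (auto simp: power_le_one)
    finally show ?thesis by simp
  qed
  obtain p where "B / norm (a m) < r ^ p" using real_arch_pow[OF r] by blast
  then have "B < norm (a m) * r ^ p" using \<open>a m \<noteq> 0\<close> by (simp add: field_simps)
  then show ?thesis using le_B[of p] by linarith
qed

context half_cut
begin

section \<open>Integrals of essentially bounded functions over levels\<close>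

definition bounded_fun :: "(real \<Rightarrow> complex) \<Rightarrow> bool" where
  "bounded_fun f \<longleftrightarrow> f \<in> borel_measurable M \<and> (\<exists>B. AE x in M. norm (f x) \<le> B)"

lemma set_integrable_bounded_fun:
  assumes "bounded_fun f" "A \<in> sets M" "emeasure M A < \<infinity>"
  shows "set_integrable M A f"
proof -
  obtain B where "AE x in M. norm (f x) \<le> B" and [measurable]: "f \<in> borel_measurable M"
    using assms(1) by (auto simp: bounded_fun_def)
  then show ?thesis
    unfolding set_integrable_def using assms(2,3)
    by (intro integrableI_bounded_set[where A = A and B = B]) (auto elim!: eventually_mono)
qed

lemma set_integrable_lv: "bounded_fun f \<Longrightarrow> i < ht n \<Longrightarrow> set_integrable M (lv n i) f"
  by (rule set_integrable_bounded_fun) (auto simp: emeasure_lv)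

lemma bounded_fun_measurable: "bounded_fun f \<Longrightarrow> f \<in> borel_measurable M"
  by (simp add: bounded_fun_def)

lemma set_integral_cong_AE_sets:
  assumes "bounded_fun f" "A \<in> sets M" "B \<in> sets M" "AE x in M. x \<in> A \<longleftrightarrow> x \<in> B"
  shows "(LINT x:A|M. f x) = (LINT x:B|M. f x)"
  using assms bounded_fun_measurable[OF assms(1)]
  by (intro set_integral_cong_set) (auto simp: set_borel_measurable_def)

text \<open>Passing to Lebesgue measure on the line makes translation between levels
  available.\<close>

lemma set_integral_lborel:
  fixes f :: "real \<Rightarrow> complex"
  assumes "A \<in> sets M"
  shows "(LINT x:A|M. f x) = (LINT x:A|lborel. f x)"
proof -
  have "(LINT x:A|M. f x) = (\<integral>x. indicator (space M) x *\<^sub>R (indicator A x *\<^sub>R f x) \<partial>lborel)"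
    unfolding set_lebesgue_integral_def using open_space_M
    by (subst M_eq, subst integral_restrict_space) auto
  also have "\<dots> = (LINT x:A|lborel. f x)"
    unfolding set_lebesgue_integral_def using sets.sets_into_space[OF assms]
    by (intro Bochner_Integration.integral_cong) (auto simp: indicator_def)
  finally show ?thesis .
qed

text \<open>From one level to the next \<open>T\<close> is the translation by \<open>t\<close>, so
  substitution turns \<open>f\<close> on the upper level into \<open>f \<circ> T\<close> on the
  lower one.\<close>

lemma set_integral_lv_Suc:
  assumes f: "bounded_fun f" and ev: "AE x in M. f (T x) = z * f x" and i: "Suc i < ht n"
  shows "(LINT x:lv n (Suc i)|M. f x) = z * (LINT x:lv n i|M. f x)"
proof -
  define t where "t = lo n (Suc i) - lo n i"
  have "(LINT x:lv n (Suc i)|M. f x) = (\<integral>x. indicator (lv n (Suc i)) x *\<^sub>R f x \<partial>lborel)"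
    using i by (simp add: set_integral_lborel) (simp add: set_lebesgue_integral_def)
  also have "\<dots> = (\<integral>x. indicator (lv n (Suc i)) (t + 1 * x) *\<^sub>R f (t + 1 * x) \<partial>lborel)"
    by (subst lborel_integral_real_affine[where c = 1 and t = t]) auto
  also have "\<dots> = (\<integral>x. indicator (lv n i) x *\<^sub>R f (T x) \<partial>lborel)"
  proof (rule Bochner_Integration.integral_cong[OF refl])
    fix x
    have "t + x \<in> lv n (Suc i) \<longleftrightarrow> x \<in> lv n i" by (auto simp: lv_eq t_def)
    moreover have "T x = t + x" if "x \<in> lv n i" using T_lv[OF that i] by (simp add: t_def)
    ultimately show "indicator (lv n (Suc i)) (t + 1 * x) *\<^sub>R f (t + 1 * x) =
        indicator (lv n i) x *\<^sub>R f (T x)"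
      by (auto simp: indicator_def)
  qed
  also have "\<dots> = (LINT x:lv n i|M. f (T x))"
    using i by (simp add: set_integral_lborel) (simp add: set_lebesgue_integral_def)
  also have "\<dots> = (LINT x:lv n i|M. z * f x)"
    using ev i bounded_fun_measurable[OF f] measurable_compose[OF T_measurable bounded_fun_measurable[OF f]]
    by (intro set_lebesgue_integral_cong_AE) (auto elim!: eventually_mono)
  finally show ?thesis by simp
qed

lemma set_integral_lv_power:
  assumes "bounded_fun f" "AE x in M. f (T x) = z * f x" "i < ht n"
  shows "(LINT x:lv n i|M. f x) = z ^ i * (LINT x:lv n 0|M. f x)"
  using assms(3) by (induction i) (auto simp: set_integral_lv_Suc[OF assms(1,2)])

lemma set_integral_lv_split:
  assumes "bounded_fun f" "i < ht n"
  shows "(LINT x:lv n i|M. f x) = (LINT x:lv (Suc n) i|M. f x) + (LINT x:lv (Suc n) (ht n + i)|M. f x)"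
proof -
  have lt: "i < ht (Suc n)" "ht n + i < ht (Suc n)" using assms(2) by auto
  have "(LINT x:lv n i|M. f x) = (LINT x:lv (Suc n) i \<union> lv (Suc n) (ht n + i)|M. f x)"
  proof (rule set_integral_cong_AE_sets[OF assms(1)])
    show "AE x in M. x \<in> lv n i \<longleftrightarrow> x \<in> lv (Suc n) i \<union> lv (Suc n) (ht n + i)"
      using AE_not_cuts
    proof eventually_elim
      case (elim x)
      then show ?case
        using lv_split[OF _ assms(2) elim] lv_left_subset[OF assms(2)] lv_right_subset[OF assms(2)]
        by blast
    qed
  qed (use assms(2) lt in \<open>auto simp del: ht.simps\<close>)
  also have "\<dots> = (LINT x:lv (Suc n) i|M. f x) + (LINT x:lv (Suc n) (ht n + i)|M. f x)"
    using lt lv_disjoint[OF lt] ht_mono[of 0 n] set_integrable_lv[OF assms(1)]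
    by (intro set_integral_Un) auto
  finally show ?thesis .
qed

text \<open>The levels of \<open>C N\<close> inside \<open>V\<close> exhaust it as \<open>N\<close>
  grows, since a point of \<open>V\<close> off the cuts lies in arbitrarily narrow levels. Each of
  them contributes 0, and the integrals pass to the limit.\<close>

lemma set_integral_open_eq_0:
  assumes g: "bounded_fun g" and zero: "\<And>n i. i < ht n \<Longrightarrow> (LINT x:lv n i|M. g x) = 0"
    and V: "open V" "V \<subseteq> lv n i" "i < ht n"
  shows "(LINT x:V|M. g x) = 0"
proof -
  define J where "J N = {j. j < ht N \<and> lv N j \<subseteq> V}" for N
  define U where "U N = (\<Union>j\<in>J N. lv N j)" for N
  have V_sets: "V \<in> sets M"
    using V lv_subset_space by (auto simp: sets_M_iff)
  have cuts_sets: "cuts \<in> sets borel" using countable_cuts by (simp add: sets.countable)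
  have U_sets: "U N \<in> sets M" for N
    unfolding U_def by (intro sets.finite_UN) (auto simp: J_def)
  have diff_sets: "A - cuts \<in> sets M" if "A \<in> sets M" for A
    using that cuts_sets by (auto simp: sets_M_iff)
  have diff_eq: "(LINT x:A - cuts|M. g x) = (LINT x:A|M. g x)" if "A \<in> sets M" for A
    using AE_not_cuts by (intro set_integral_cong_AE_sets[OF g diff_sets] that) (auto elim!: eventually_mono)
  have "(LINT x:U N|M. g x) = (\<Sum>j\<in>J N. LINT x:lv N j|M. g x)" for N
    unfolding U_def using set_integrable_lv[OF g] lv_disjoint
    by (intro set_integral_finite_Union) (auto simp: J_def disjoint_family_on_def)
  then have U0: "(LINT x:U N|M. g x) = 0" for N
    by (simp add: J_def zero)
  \<comment> \<open>Before the cuts are removed the sets may fail to increase: the midpoint of a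
    level in \<open>U N\<close> can be missing from \<open>U (Suc N)\<close>.\<close>
  have "incseq (\<lambda>N. U N - cuts)"
  proof (intro incseq_SucI subsetI)
    fix N x assume "x \<in> U N - cuts"
    then obtain j where j: "j < ht N" "lv N j \<subseteq> V" "x \<in> lv N j" "x \<notin> cuts"
      by (auto simp: U_def J_def)
    then have "j \<in> J (Suc N)" "ht N + j \<in> J (Suc N)"
      using lv_left_subset[OF j(1)] lv_right_subset[OF j(1)] by (auto simp: J_def)
    then show "x \<in> U (Suc N) - cuts"
      using lv_split[OF j(3,1,4)] j(4) by (auto simp: U_def)
  qed
  moreover have UV: "(\<Union>N. U N - cuts) = V - cuts"
  proof
    show "(\<Union>N. U N - cuts) \<subseteq> V - cuts" by (auto simp: U_def J_def)
    show "V - cuts \<subseteq> (\<Union>N. U N - cuts)"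
    proof
      fix x assume x: "x \<in> V - cuts"
      then obtain e where e: "0 < e" "ball x e \<subseteq> V" using V(1) openE by blast
      obtain k where k: "(1/2) ^ k < e" using real_arch_pow_inv[of e "1/2"] e(1) by auto
      define N where "N = n + k"
      have "(1/2 :: real) ^ N \<le> (1/2) ^ k" by (intro power_decreasing) (auto simp: N_def)
      then have N: "(1/2) ^ N < e" using k by linarith
      obtain D where D: "D \<subseteq> {n..<N}" "x \<in> lv N (i + sum ht D)"
        using lv_descend[of x n i N] x V by (auto simp: N_def)
      have "i + sum ht D < ht N" using ht_add_sum_less[OF V(3) _ D(1)] by (simp add: N_def)
      moreover have "lv N (i + sum ht D) \<subseteq> ball x e"
        using D(2) N by (auto simp: lv_eq dist_real_def)
      ultimately have "i + sum ht D \<in> J N" using e(2) by (auto simp: J_def)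
      then show "x \<in> (\<Union>N. U N - cuts)" using D(2) x by (auto simp: U_def)
    qed
  qed
  moreover have "emeasure M (V - cuts) < \<infinity>"
  proof -
    have "emeasure M (V - cuts) \<le> emeasure M (lv n i)"
      using V(2,3) by (intro emeasure_mono) auto
    also have "\<dots> < \<infinity>" using V(3) by (simp add: emeasure_lv)
    finally show ?thesis .
  qed
  ultimately have "(\<lambda>N. LINT x:U N - cuts|M. g x) \<longlonglongrightarrow> (LINT x:V - cuts|M. g x)"
    using set_integral_cont_up[of "\<lambda>N. U N - cuts" M g]
      set_integrable_bounded_fun[OF g diff_sets[OF V_sets]] diff_sets[OF U_sets]
    by auto
  then show ?thesis
    using U0 U_sets V_sets by (simp add: diff_eq LIMSEQ_const_iff)
qed

text \<open>Dynkin's argument on each level: open sets are stable under intersection and generate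
  the Borel sets, and the sets over whose trace on the level \<open>g\<close> integrates to 0 form a
  Dynkin system. Hence \<open>g\<close> is a zero density there.\<close>

lemma AE_zero_if_lv_integrals_zero:
  assumes g: "bounded_fun g" and zero: "\<And>n i. i < ht n \<Longrightarrow> (LINT x:lv n i|M. g x) = 0"
  shows "AE x in M. g x = 0"
proof -
  have level: "AE x in M. x \<in> lv n i \<longrightarrow> g x = 0" if i: "i < ht n" for n i
  proof -
    \<comment> \<open>Truncation to one level gives integrability; on the whole space
      \<open>g\<close> need not be integrable.\<close>
    define h where "h x = indicator (lv n i) x *\<^sub>R g x" for x
    have int: "integrable M h"
      using set_integrable_lv[OF g i] by (simp add: set_integrable_def h_def[abs_def])
    have Int_sets: "A \<inter> lv n i \<in> sets M" if "A \<in> sets borel" for A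
      using that lv_subset_space[OF i] by (auto simp: sets_M_iff)
    have si: "set_integrable M (A \<inter> lv n i) g" if "A \<in> sets borel" for A
      using set_integrable_subset[OF set_integrable_lv[OF g i] Int_sets[OF that]] by blast
    have stable: "Int_stable {U :: real set. open U}" by (auto simp: Int_stable_def)
    have subs: "{U :: real set. open U} \<subseteq> Pow UNIV" by simp
    have eq: "(LINT x:A \<inter> lv n i|M. g x) = 0" if "A \<in> sigma_sets UNIV {U. open U}" for A
      using stable subs that
    proof (induction rule: sigma_sets_induct_disjoint)
      case (basic U)
      then show ?case
        by (intro set_integral_open_eq_0[OF g zero _ _ i]) auto
    next
      case empty
      then show ?case by (simp add: set_lebesgue_integral_def)
    next
      case (compl A)
      then have A: "A \<in> sets borel" by (simp add: borel_def)
      have "lv n i = A \<inter> lv n i \<union> (UNIV - A) \<inter> lv n i" by blast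
      then have "(LINT x:lv n i|M. g x) = (LINT x:A \<inter> lv n i \<union> (UNIV - A) \<inter> lv n i|M. g x)"
        by simp
      also have "\<dots> = (LINT x:A \<inter> lv n i|M. g x) + (LINT x:(UNIV - A) \<inter> lv n i|M. g x)"
        using A by (intro set_integral_Un si) auto
      finally show ?case using zero[OF i] compl by simp
    next
      case (union A)
      then have A: "A k \<in> sets borel" for k by (auto simp: borel_def)
      have "(LINT x:(\<Union>k. A k \<inter> lv n i)|M. g x) = (\<Sum>k. LINT x:A k \<inter> lv n i|M. g x)"
        using union(1) Int_sets[OF A] si[of "\<Union>k. A k"] A
        by (intro lebesgue_integral_countable_add) (auto simp: disjoint_family_on_def)
      then show ?case using union by simp
    qed
    have "AE x in M. h x = 0"
    proof (rule sigma_finite_measure.density_zero[OF sigma_finite_M int])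
      fix A assume "A \<in> sets M"
      then have "A \<in> sigma_sets UNIV {U. open U}" by (simp add: sets_M_iff borel_def)
      then have "(LINT x:A \<inter> lv n i|M. g x) = 0" by (rule eq)
      then show "(LINT x:A|M. h x) = 0"
        by (simp add: set_lebesgue_integral_def h_def indicator_inter_arith)
    qed
    then show ?thesis by eventually_elim (auto simp: h_def)
  qed
  have "AE x in M. \<forall>n i. i < ht n \<longrightarrow> x \<in> lv n i \<longrightarrow> g x = 0"
    unfolding AE_all_countable
  proof (intro allI)
    fix n i
    show "AE x in M. i < ht n \<longrightarrow> x \<in> lv n i \<longrightarrow> g x = 0"
      using level[of i n] by (cases "i < ht n") auto
  qed
  then show ?thesis
    using AE_space by eventually_elim (auto simp: space_M)
qed

lemma spectrally_weakly_mixing: "spectrally_weakly_mixing M T"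
  unfolding spectrally_weakly_mixing_def
proof (intro allI impI)
  fix f :: "real \<Rightarrow> complex" and z :: complex
  assume meas: "f \<in> borel_measurable M" and "\<exists>B. AE x in M. norm (f x) \<le> B"
    and ev: "AE x in M. f (T x) = z * f x"
  then obtain B where B: "AE x in M. norm (f x) \<le> B" by blast
  have f: "bounded_fun f" using meas B by (auto simp: bounded_fun_def)
  define a where "a n = (LINT x:lv n 0|M. f x)" for n
  have ht_pos: "0 < ht n" for n using less_ht[of n] by linarith
  have lv_int: "(LINT x:lv n i|M. f x) = z ^ i * a n" if "i < ht n" for n i
    unfolding a_def using f ev that by (rule set_integral_lv_power)
  \<comment> \<open>The right half of the bottom level of \<open>C n\<close> is level
    \<open>ht n\<close> of \<open>C (Suc n)\<close>.\<close>
  have rec: "a n = (1 + z ^ ht n) * a (Suc n)" for n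
    using set_integral_lv_split[OF f ht_pos[of n]] lv_int[of "ht n" "Suc n"] ht_pos[of n]
    by (simp add: a_def distrib_right)
  show "\<exists>c. AE x in M. f x = c"
  proof (cases "\<forall>n. a n = 0")
    case True
    then have "AE x in M. f x = 0"
      using lv_int by (intro AE_zero_if_lv_integrals_zero[OF f]) auto
    then show ?thesis by blast
  next
    case False
    then obtain m where m: "a m \<noteq> 0" by blast
    have bound: "norm (z ^ i * a n) \<le> B * (1/2) ^ n" if i: "i < ht n" for n i
    proof -
      have "norm (LINT x:lv n i|M. f x) \<le> (\<integral>x. norm (indicator (lv n i) x *\<^sub>R f x) \<partial>M)"
        unfolding set_lebesgue_integral_def by (rule integral_norm_bound)
      also have "\<dots> \<le> (LINT x:lv n i|M. B)"
        unfolding set_lebesgue_integral_def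
        using B set_integrable_lv[OF f i] i emeasure_lv[OF i]
        by (intro integral_mono_AE integrable_norm integrable_scaleR_left integrable_real_indicator)
          (auto simp: set_integrable_def indicator_def elim!: eventually_mono)
      also have "\<dots> = B * (1/2) ^ n"
        using i by (simp add: set_lebesgue_integral_def measure_lv Int_absorb2 sets.sets_into_space)
      finally show ?thesis using lv_int[OF i] by simp
    qed
    have z: "z = 1" using rec bound m by (rule eigenvalue_eq_1)
    \<comment> \<open>With \<open>z = 1\<close> the recursion reads
      \<open>a n = 2 * a (Suc n)\<close>, so \<open>f\<close> has mean \<open>a 0\<close> on every
      level of every column; this is the constant to subtract.\<close>
    have a: "a n = a 0 * (1/2) ^ n" for n
    proof (induction n)
      case (Suc n)
      then show ?case using rec[of n] z by (simp add: field_simps)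
    qed simp
    define g where "g x = f x - a 0" for x
    have "AE x in M. norm (g x) \<le> B + norm (a 0)"
      using B by eventually_elim (auto simp: g_def intro: order_trans[OF norm_triangle_ineq4])
    then have g: "bounded_fun g"
      using meas by (auto simp: bounded_fun_def g_def[abs_def])
    have "AE x in M. g x = 0"
    proof (rule AE_zero_if_lv_integrals_zero[OF g])
      fix n i assume i: "i < ht n"
      have const: "bounded_fun (\<lambda>_. a 0)" by (auto simp: bounded_fun_def)
      have "(LINT x:lv n i|M. g x) = (LINT x:lv n i|M. f x) - (LINT x:lv n i|M. a 0)"
        unfolding g_def using set_integrable_lv[OF f i] set_integrable_lv[OF const i]
        by (rule set_integral_diff)
      also have "(LINT x:lv n i|M. a 0) = a 0 * (1/2) ^ n"
        using i by (simp add: set_lebesgue_integral_def measure_lv scaleR_conv_of_real)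
      finally show "(LINT x:lv n i|M. g x) = 0"
        using lv_int[OF i] a[of n] z by simp
    qed
    then show ?thesis by (intro exI[of _ "a 0"]) (auto simp: g_def)
  qed
qed

end

theorem corollary3p3:
  fixes C :: "nat \<Rightarrow> column" and T :: "real \<Rightarrow> real"
  assumes "rank_one_columns (\<lambda>n. 2) (\<lambda>n k. if k = 1 then 2 * height (C n) + 1 else 0) C"
    and "rank_one_map C T"
  shows "rationally_ergodic (rank_one_space C) T \<and>
         spectrally_weakly_mixing (rank_one_space C) T \<and>
         \<not> rationally_weakly_mixing (rank_one_space C) T"
proof -
  interpret half_cut C T by unfold_locales (use assms in auto)
  show ?thesis
    using rationally_ergodic spectrally_weakly_mixing not_rationally_weakly_mixing by blast
qed

end
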